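(* Let $X$ be a $T_4$ space. Then $X$ is densely weak $F_\sigma$-embedded in $\mathcal{M}(B_1(X))$; that is, there is a weak $F_\sigma$-embedding of $X$ into $\mathcal{M}(B_1(X))$ whose image is dense in $\mathcal{M}(B_1(X))$.
   Context: A $T_4$ space is a normal $T_1$ space. $B_1(X)$ is the ring of Baire one functions on $X$, i.e. pointwise limits of sequences of continuous functions $X\to\mathbb{R}$. $\mathcal{M}(B_1(X))$ is the set of all maximal ideals of $B_1(X)$ with the hull-kernel topology: the sets $\widehat{\mathscr{M}_f}=\{\widehat{M}\in\mathcal{M}(B_1(X)): f\in\widehat{M}\}$, $f\in B_1(X)$, form a base for closed sets. The basic closed sets of $\mathcal{M}(B_1(X))$ are the sets $\widehat{\mathscr{M}_f}$ and its basic open sets are their complements. A function $f:X\to Y$ is weak $F_\sigma$-continuous if $f^{-1}(U)$ is an $F_\sigma$ set in $X$ for every basic open set $U$ of $Y$. It is a weak $F_\sigma$-embedding if it is injective, weak $F_\sigma$-continuous, and $f^{-1}:f(X)\to X$ is continuous (with $f(X)$ carrying the subspace topology). *)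

theory Defs
  imports "HOL-Analysis.Analysis" "HOL-Algebra.Ideal"
begin

section \<open>The ring of Baire one functions\<close>

definition baire_one :: "'a topology \<Rightarrow> ('a \<Rightarrow> real) \<Rightarrow> bool" where
  "baire_one X f \<longleftrightarrow>
     (\<exists>g. (\<forall>n::nat. continuous_map X euclideanreal (g n)) \<and>
          (\<forall>x\<in>topspace X. (\<lambda>n. g n x) \<longlonglongrightarrow> f x))"

text \<open>Functions \<open>topspace X \<rightarrow> \<real>\<close> are represented by their extensional representatives
  (value \<open>undefined\<close> off \<open>topspace X\<close>), so that distinct ring elements are distinct functions
  on \<open>X\<close>.\<close>

definition baire_one_ring :: "'a topology \<Rightarrow> ('a \<Rightarrow> real) ring" where
  "baire_one_ring X =
     \<lparr>carrier = {f \<in> extensional (topspace X). baire_one X f},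
      mult = (\<lambda>f g. \<lambda>x\<in>topspace X. f x * g x),
      one = (\<lambda>x\<in>topspace X. 1),
      zero = (\<lambda>x\<in>topspace X. 0),
      add = (\<lambda>f g. \<lambda>x\<in>topspace X. f x + g x)\<rparr>"

lemma baire_one_ring_simps:
  "carrier (baire_one_ring X) = {f \<in> extensional (topspace X). baire_one X f}"
  "f \<otimes>\<^bsub>baire_one_ring X\<^esub> g = (\<lambda>x\<in>topspace X. f x * g x)"
  "\<one>\<^bsub>baire_one_ring X\<^esub> = (\<lambda>x\<in>topspace X. 1)"
  "\<zero>\<^bsub>baire_one_ring X\<^esub> = (\<lambda>x\<in>topspace X. 0)"
  "f \<oplus>\<^bsub>baire_one_ring X\<^esub> g = (\<lambda>x\<in>topspace X. f x + g x)"
  by (simp_all add: baire_one_ring_def)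

lemma baire_one_cong:
  assumes "\<And>x. x \<in> topspace X \<Longrightarrow> f x = g x"
  shows "baire_one X f \<longleftrightarrow> baire_one X g"
  using assms by (simp add: baire_one_def)

lemma baire_one_restrict [simp]: "baire_one X (restrict f (topspace X)) \<longleftrightarrow> baire_one X f"
  by (rule baire_one_cong) simp

lemma baire_one_const: "baire_one X (\<lambda>x. c)"
  unfolding baire_one_def by (intro exI [of _ "\<lambda>n x. c"]) simp

lemma baire_one_add:
  assumes "baire_one X f" "baire_one X g"
  shows "baire_one X (\<lambda>x. f x + g x)"
proof -
  obtain F G where
    "\<And>n::nat. continuous_map X euclideanreal (F n)" "\<forall>x\<in>topspace X. (\<lambda>n. F n x) \<longlonglongrightarrow> f x"
    "\<And>n::nat. continuous_map X euclideanreal (G n)" "\<forall>x\<in>topspace X. (\<lambda>n. G n x) \<longlonglongrightarrow> g x"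
    using assms unfolding baire_one_def by blast
  then show ?thesis
    unfolding baire_one_def
    by (intro exI [of _ "\<lambda>n x. F n x + G n x"])
       (auto intro!: continuous_map_add tendsto_add)
qed

lemma baire_one_mult:
  assumes "baire_one X f" "baire_one X g"
  shows "baire_one X (\<lambda>x. f x * g x)"
proof -
  obtain F G where
    "\<And>n::nat. continuous_map X euclideanreal (F n)" "\<forall>x\<in>topspace X. (\<lambda>n. F n x) \<longlonglongrightarrow> f x"
    "\<And>n::nat. continuous_map X euclideanreal (G n)" "\<forall>x\<in>topspace X. (\<lambda>n. G n x) \<longlonglongrightarrow> g x"
    using assms unfolding baire_one_def by blast
  then show ?thesis
    unfolding baire_one_def
    by (intro exI [of _ "\<lambda>n x. F n x * G n x"])
       (auto intro!: continuous_map_real_mult tendsto_mult)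
qed

lemma cring_baire_one_ring: "cring (baire_one_ring X)"
proof -
  let ?R = "baire_one_ring X" and ?S = "topspace X"
  have add: "(\<lambda>x\<in>?S. f x + g x) \<in> carrier ?R"
    and mult: "(\<lambda>x\<in>?S. f x * g x) \<in> carrier ?R"
    if "f \<in> carrier ?R" "g \<in> carrier ?R" for f g
    using that by (simp_all add: baire_one_ring_simps baire_one_add baire_one_mult)
  have const: "(\<lambda>x\<in>?S. c) \<in> carrier ?R" for c
    by (simp add: baire_one_ring_simps baire_one_const)
  have off: "f x = undefined" if "f \<in> carrier ?R" "x \<notin> ?S" for f x
    using that by (simp add: baire_one_ring_simps extensional_def)
  note ops = baire_one_ring_simps(2-)
  show ?thesis
  proof (rule cringI)
    show "abelian_group ?R"
    proof (rule abelian_groupI)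
      fix f assume f: "f \<in> carrier ?R"
      show "\<exists>g\<in>carrier ?R. g \<oplus>\<^bsub>?R\<^esub> f = \<zero>\<^bsub>?R\<^esub>"
      proof (rule bexI)
        show "(\<lambda>x\<in>?S. (\<lambda>x\<in>?S. - 1) x * f x) \<in> carrier ?R"
          by (rule mult [OF const f])
        show "(\<lambda>x\<in>?S. (\<lambda>x\<in>?S. - 1) x * f x) \<oplus>\<^bsub>?R\<^esub> f = \<zero>\<^bsub>?R\<^esub>"
          unfolding ops by (rule ext) simp
      qed
      show "\<zero>\<^bsub>?R\<^esub> \<oplus>\<^bsub>?R\<^esub> f = f"
        unfolding ops by (rule ext) (simp add: restrict_def off [OF f])
    next
      fix f g h
      show "f \<oplus>\<^bsub>?R\<^esub> g \<oplus>\<^bsub>?R\<^esub> h = f \<oplus>\<^bsub>?R\<^esub> (g \<oplus>\<^bsub>?R\<^esub> h)"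
        unfolding ops by (rule ext) (simp add: restrict_def)
      show "f \<oplus>\<^bsub>?R\<^esub> g = g \<oplus>\<^bsub>?R\<^esub> f"
        unfolding ops by (simp add: add.commute)
    qed (use add const in \<open>simp_all only: ops\<close>)
    show "comm_monoid ?R"
    proof (rule comm_monoidI)
      fix f assume f: "f \<in> carrier ?R"
      show "\<one>\<^bsub>?R\<^esub> \<otimes>\<^bsub>?R\<^esub> f = f"
        unfolding ops by (rule ext) (simp add: restrict_def off [OF f])
    next
      fix f g h
      show "f \<otimes>\<^bsub>?R\<^esub> g \<otimes>\<^bsub>?R\<^esub> h = f \<otimes>\<^bsub>?R\<^esub> (g \<otimes>\<^bsub>?R\<^esub> h)"
        unfolding ops by (rule ext) (simp add: restrict_def)
      show "f \<otimes>\<^bsub>?R\<^esub> g = g \<otimes>\<^bsub>?R\<^esub> f"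
        unfolding ops by (simp add: mult.commute)
    qed (use mult const in \<open>simp_all only: ops\<close>)
    fix f g h
    show "(f \<oplus>\<^bsub>?R\<^esub> g) \<otimes>\<^bsub>?R\<^esub> h = f \<otimes>\<^bsub>?R\<^esub> h \<oplus>\<^bsub>?R\<^esub> g \<otimes>\<^bsub>?R\<^esub> h"
      unfolding ops by (rule ext) (simp add: restrict_def distrib_right)
  qed
qed


section \<open>The maximal ideal space with the hull-kernel topology\<close>

definition max_ideals :: "('a, 'b) ring_scheme \<Rightarrow> 'a set set" where
  "max_ideals R = {I. maximalideal I R}"

definition max_hull :: "('a, 'b) ring_scheme \<Rightarrow> 'a \<Rightarrow> 'a set set" where
  "max_hull R f = {I \<in> max_ideals R. f \<in> I}"

definition max_basic_opens :: "('a, 'b) ring_scheme \<Rightarrow> 'a set set set" where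
  "max_basic_opens R = {max_ideals R - max_hull R f | f. f \<in> carrier R}"

definition hull_kernel_topology :: "('a, 'b) ring_scheme \<Rightarrow> 'a set topology" where
  "hull_kernel_topology R = topology (arbitrary union_of (\<lambda>U. U \<in> max_basic_opens R))"

text \<open>For a commutative ring, the argument of \<^const>\<open>topology\<close> above is indeed a topology.\<close>

lemma max_basic_opens_Int:
  assumes "cring R" "U \<in> max_basic_opens R" "V \<in> max_basic_opens R"
  shows "U \<inter> V \<in> max_basic_opens R"
proof -
  interpret cring R by fact
  obtain f g where f: "f \<in> carrier R" "U = max_ideals R - max_hull R f"
    and g: "g \<in> carrier R" "V = max_ideals R - max_hull R g"
    using assms unfolding max_basic_opens_def by blast
  have "f \<otimes>\<^bsub>R\<^esub> g \<in> I \<longleftrightarrow> f \<in> I \<or> g \<in> I" if "maximalideal I R" for I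
  proof -
    interpret primeideal I R using that by (rule maximalideal_prime)
    show ?thesis
    proof
      show "f \<otimes>\<^bsub>R\<^esub> g \<in> I \<Longrightarrow> f \<in> I \<or> g \<in> I"
        by (rule I_prime [OF f(1) g(1)])
      show "f \<in> I \<or> g \<in> I \<Longrightarrow> f \<otimes>\<^bsub>R\<^esub> g \<in> I"
        using I_l_closed [OF _ f(1)] I_r_closed [OF _ g(1)] by fast
    qed
  qed
  then have "U \<inter> V = max_ideals R - max_hull R (f \<otimes>\<^bsub>R\<^esub> g)"
    unfolding f(2) g(2) max_hull_def max_ideals_def by auto
  moreover have "f \<otimes>\<^bsub>R\<^esub> g \<in> carrier R"
    by (rule m_closed [OF f(1) g(1)])
  ultimately show ?thesis
    unfolding max_basic_opens_def by auto
qed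

lemma openin_hull_kernel_topology:
  assumes "cring R"
  shows "openin (hull_kernel_topology R) = arbitrary union_of (\<lambda>U. U \<in> max_basic_opens R)"
  unfolding hull_kernel_topology_def
  by (intro topology_inverse' istopology_base max_basic_opens_Int assms)

lemma topspace_hull_kernel_topology:
  assumes "cring R"
  shows "topspace (hull_kernel_topology R) = max_ideals R"
proof (rule subset_antisym)
  show "topspace (hull_kernel_topology R) \<subseteq> max_ideals R"
    unfolding topspace_def openin_hull_kernel_topology [OF assms]
    by (fastforce simp: union_of_def max_basic_opens_def)
  interpret cring R by fact
  have "\<one>\<^bsub>R\<^esub> \<notin> I" if "maximalideal I R" for I
  proof -
    interpret maximalideal I R by fact
    show ?thesis using I_notcarr one_imp_carrier by metis
  qed
  then have "max_ideals R - max_hull R \<one>\<^bsub>R\<^esub> = max_ideals R"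
    unfolding max_hull_def max_ideals_def by auto
  then have "max_ideals R \<in> max_basic_opens R"
    unfolding max_basic_opens_def using one_closed by blast
  then have "openin (hull_kernel_topology R) (max_ideals R)"
    by (simp add: openin_hull_kernel_topology [OF assms] arbitrary_union_of_inc)
  then show "max_ideals R \<subseteq> topspace (hull_kernel_topology R)"
    by (rule openin_subset)
qed


section \<open>Weak $F_\sigma$-embeddings\<close>

text \<open>Weak $F_\sigma$-continuity depends on the family \<open>\<B>\<close> of basic open sets chosen for the
  codomain, not only on its topology, so \<open>\<B>\<close> is an explicit parameter.\<close>

definition weak_fsigma_continuous_map ::
    "'a topology \<Rightarrow> 'b topology \<Rightarrow> 'b set set \<Rightarrow> ('a \<Rightarrow> 'b) \<Rightarrow> bool" where
  "weak_fsigma_continuous_map X Y \<B> f \<longleftrightarrow>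
     f \<in> topspace X \<rightarrow> topspace Y \<and>
     (\<forall>U\<in>\<B>. fsigma_in X {x \<in> topspace X. f x \<in> U})"

definition weak_fsigma_embedding_map ::
    "'a topology \<Rightarrow> 'b topology \<Rightarrow> 'b set set \<Rightarrow> ('a \<Rightarrow> 'b) \<Rightarrow> bool" where
  "weak_fsigma_embedding_map X Y \<B> f \<longleftrightarrow>
     inj_on f (topspace X) \<and>
     weak_fsigma_continuous_map X Y \<B> f \<and>
     continuous_map (subtopology Y (f ` topspace X)) X (the_inv_into (topspace X) f)"

end

theory Submission
  imports Defs
begin

text \<open>
  The embedding sends a point \<open>x\<close> to the ideal \<open>M\<^sub>x\<close> of all Baire one functions that vanish
  at \<open>x\<close>. Since constants are Baire one, \<open>M\<^sub>x\<close> is the kernel of a surjective evaluation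
  homomorphism onto the field of real numbers, hence maximal. Everything then rests on the
  equivalence \<open>f \<in> M\<^sub>x \<longleftrightarrow> f x = 0\<close>: under \<open>x \<mapsto> M\<^sub>x\<close>, a basic open set
  \<open>{M. f \<notin> M}\<close> pulls back to the cozero set of the Baire one function \<open>f\<close>. Its three
  consequences are as follows.

  \<^item> Weak $F_\sigma$-continuity: the cozero set of a pointwise limit of continuous functions is
    an $F_\sigma$ set (\<open>fsigma_in_cozero_baire_one\<close>).

  \<^item> Density: a function that lies outside some maximal ideal is not the zero function, so its
    cozero set is nonempty (\<open>eval_kernel_dense\<close>).

  \<^item> Injectivity and continuity of the inverse: a normal \<open>T\<^sub>1\<close> space is completely regular, so
    the cozero sets of continuous functions already form a base of the topology of \<open>X\<close>
    (\<open>baire_one_ring_separates\<close>). Continuous functions are Baire one, so every open set of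
    \<open>X\<close> is a union of preimages of basic open sets.
\<close>

section \<open>Cozero sets of Baire one functions\<close>

lemma continuous_imp_baire_one:
  assumes "continuous_map X euclideanreal f"
  shows "baire_one X f"
  unfolding baire_one_def using assms by (intro exI [of _ "\<lambda>n. f"]) simp

text \<open>
  If \<open>g n x\<close> converges to \<open>f x\<close>, then \<open>f x \<noteq> 0\<close> exactly when \<open>\<bar>g n x\<bar>\<close> is eventually bounded
  away from zero. As the bounds may be taken of the form \<open>1 / (k + 1)\<close>, this is a countable
  union, over \<open>k\<close> and over the index from which the bound holds, of closed conditions.
\<close>
lemma fsigma_in_cozero_baire_one:
  assumes "baire_one X f"
  shows "fsigma_in X {x \<in> topspace X. f x \<noteq> 0}"
proof -
  obtain g :: "nat \<Rightarrow> 'a \<Rightarrow> real"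
    where g: "\<And>n. continuous_map X euclideanreal (g n)"
      and lim: "\<And>x. x \<in> topspace X \<Longrightarrow> (\<lambda>n. g n x) \<longlonglongrightarrow> f x"
    using assms unfolding baire_one_def by blast
  define C where
    "C k N = (\<Inter>n\<in>{N..}. {x \<in> topspace X. \<bar>g n x\<bar> \<in> {inverse (real (Suc k))..}})" for k N
  have closed: "closedin X (C k N)" for k N
    unfolding C_def
  proof (rule closedin_INT)
    fix n
    have "continuous_map X euclideanreal (\<lambda>x. \<bar>g n x\<bar>)"
      by (rule continuous_map_real_abs [OF g])
    then show "closedin X {x \<in> topspace X. \<bar>g n x\<bar> \<in> {inverse (real (Suc k))..}}"
      by (rule closedin_continuous_map_preimage) simp
  qed simp
  have "{x \<in> topspace X. f x \<noteq> 0} = (\<Union>k. \<Union>N. C k N)"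
  proof (intro subset_antisym subsetI)
    fix x assume "x \<in> {x \<in> topspace X. f x \<noteq> 0}"
    then have x: "x \<in> topspace X" and "0 < \<bar>f x\<bar>" by auto
    then obtain k where "inverse (real (Suc k)) < \<bar>f x\<bar>"
      using reals_Archimedean by blast
    then have "\<forall>\<^sub>F n in sequentially. inverse (real (Suc k)) < \<bar>g n x\<bar>"
      by (rule order_tendstoD(1) [OF tendsto_rabs [OF lim [OF x]]])
    then obtain N where "\<And>n. n \<ge> N \<Longrightarrow> inverse (real (Suc k)) < \<bar>g n x\<bar>"
      unfolding eventually_sequentially by blast
    then have "x \<in> C k N"
      using x by (auto simp: C_def intro: less_imp_le)
    then show "x \<in> (\<Union>k. \<Union>N. C k N)" by blast
  next
    fix x assume "x \<in> (\<Union>k. \<Union>N. C k N)"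
    then obtain k N where x: "x \<in> topspace X"
      and bound: "\<And>n. n \<ge> N \<Longrightarrow> inverse (real (Suc k)) \<le> \<bar>g n x\<bar>"
      by (fastforce simp: C_def)
    have "inverse (real (Suc k)) \<le> \<bar>f x\<bar>"
      by (rule LIMSEQ_le_const [OF tendsto_rabs [OF lim [OF x]]]) (use bound in blast)
    moreover have "0 < inverse (real (Suc k))" by simp
    ultimately show "x \<in> {x \<in> topspace X. f x \<noteq> 0}"
      using x by force
  qed
  moreover have "fsigma_in X (\<Union>N. C k N)" for k
    by (rule fsigma_in_Union) (auto intro: closed_imp_fsigma_in closed)
  then have "fsigma_in X (\<Union>k. \<Union>N. C k N)"
    by (intro fsigma_in_Union) auto
  ultimately show ?thesis by simp
qed

section \<open>The maximal ideal of a point\<close>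

definition eval_kernel :: "'a topology \<Rightarrow> 'a \<Rightarrow> ('a \<Rightarrow> real) set" where
  "eval_kernel X x = {f \<in> carrier (baire_one_ring X). f x = 0}"

text \<open>
  An ideal strictly larger than \<open>M\<^sub>x\<close> contains some \<open>f\<close> with \<open>f x \<noteq> 0\<close>. For every Baire one
  \<open>h\<close> and the constant \<open>c = h x / f x\<close>, the difference \<open>h - c f\<close> vanishes at \<open>x\<close>, so \<open>h\<close> is
  the sum of an element of \<open>M\<^sub>x\<close> and a multiple of \<open>f\<close>.
\<close>
lemma maximalideal_eval_kernel:
  assumes x: "x \<in> topspace X"
  shows "maximalideal (eval_kernel X x) (baire_one_ring X)"
proof -
  let ?R = "baire_one_ring X" and ?S = "topspace X"
  interpret R: cring ?R by (rule cring_baire_one_ring)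
  have const: "(\<lambda>y\<in>?S. c) \<in> carrier ?R" for c
    by (simp add: baire_one_ring_simps baire_one_const)
  show ?thesis
  proof (rule maximalidealI)
    show "ideal (eval_kernel X x) ?R"
    proof (rule idealI)
      show "ring ?R" by (rule R.ring_axioms)
      show "subgroup (eval_kernel X x) (add_monoid ?R)"
      proof (rule group.subgroupI [OF R.a_group])
        show "eval_kernel X x \<subseteq> carrier (add_monoid ?R)"
          by (auto simp: eval_kernel_def)
        have "\<zero>\<^bsub>?R\<^esub> \<in> eval_kernel X x"
          using x by (simp add: eval_kernel_def) (simp add: baire_one_ring_simps)
        then show "eval_kernel X x \<noteq> {}" by blast
        fix f assume f: "f \<in> eval_kernel X x"
        then have fR: "f \<in> carrier ?R" by (simp add: eval_kernel_def)
        have "(f \<oplus>\<^bsub>?R\<^esub> (\<ominus>\<^bsub>?R\<^esub> f)) x = \<zero>\<^bsub>?R\<^esub> x"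
          by (simp only: R.r_neg [OF fR])
        then have "\<ominus>\<^bsub>?R\<^esub> f \<in> eval_kernel X x"
          using f x R.a_inv_closed [OF fR]
          by (simp add: eval_kernel_def baire_one_ring_simps(4,5))
        then show "inv\<^bsub>add_monoid ?R\<^esub> f \<in> eval_kernel X x"
          by (simp add: a_inv_def)
        fix g assume g: "g \<in> eval_kernel X x"
        then have "f \<oplus>\<^bsub>?R\<^esub> g \<in> carrier ?R"
          using fR by (simp add: eval_kernel_def)
        then show "f \<otimes>\<^bsub>add_monoid ?R\<^esub> g \<in> eval_kernel X x"
          using f g x by (simp add: eval_kernel_def baire_one_ring_simps(5))
      qed
      fix f h assume "f \<in> eval_kernel X x" "h \<in> carrier ?R"
      then have "h \<otimes>\<^bsub>?R\<^esub> f \<in> carrier ?R" and "(h \<otimes>\<^bsub>?R\<^esub> f) x = 0"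
        and "f \<otimes>\<^bsub>?R\<^esub> h \<in> carrier ?R" and "(f \<otimes>\<^bsub>?R\<^esub> h) x = 0"
        using x by (simp_all add: eval_kernel_def) (simp_all add: baire_one_ring_simps(2))
      then show "h \<otimes>\<^bsub>?R\<^esub> f \<in> eval_kernel X x" and "f \<otimes>\<^bsub>?R\<^esub> h \<in> eval_kernel X x"
        by (simp_all add: eval_kernel_def)
    qed
    have "(\<lambda>y\<in>?S. 1) \<notin> eval_kernel X x"
      using x by (simp add: eval_kernel_def)
    then show "carrier ?R \<noteq> eval_kernel X x"
      using const by blast
    fix J assume J: "ideal J ?R" and sub: "eval_kernel X x \<subseteq> J" and "J \<subseteq> carrier ?R"
    interpret J: ideal J ?R by (rule J)
    show "J = eval_kernel X x \<or> J = carrier ?R"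
    proof (rule disjCI)
      assume "J \<noteq> carrier ?R"
      have "f x = 0" if f: "f \<in> J" for f
      proof (rule ccontr)
        assume nz: "f x \<noteq> 0"
        have fR: "f \<in> carrier ?R" using f by (rule J.a_Hcarr)
        have "h \<in> J" if h: "h \<in> carrier ?R" for h
        proof -
          define p where "p = (\<lambda>y\<in>?S. h x / f x) \<otimes>\<^bsub>?R\<^esub> f"
          define q where "q = h \<oplus>\<^bsub>?R\<^esub> ((\<lambda>y\<in>?S. - 1) \<otimes>\<^bsub>?R\<^esub> p)"
          have p: "p \<in> J"
            unfolding p_def by (rule J.I_l_closed [OF f const])
          then have "q \<in> carrier ?R"
            unfolding q_def by (intro R.a_closed R.m_closed const h J.a_Hcarr)
          moreover have "q x = 0"
            using x nz by (simp add: q_def p_def baire_one_ring_simps(2,5))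
          ultimately have "q \<in> J"
            using sub by (auto simp: eval_kernel_def)
          then have "q \<oplus>\<^bsub>?R\<^esub> p \<in> J"
            by (rule J.a_closed) (rule p)
          moreover have "q \<oplus>\<^bsub>?R\<^esub> p = h"
            using h by (auto simp: q_def baire_one_ring_simps restrict_def extensional_def)
          ultimately show ?thesis by simp
        qed
        with \<open>J \<subseteq> carrier ?R\<close> \<open>J \<noteq> carrier ?R\<close> show False by blast
      qed
      then show "J = eval_kernel X x"
        using sub \<open>J \<subseteq> carrier ?R\<close> by (auto simp: eval_kernel_def)
    qed
  qed
qed

section \<open>Weak $F_\sigma$-continuity and density\<close>

lemma eval_kernel_in_basic_open_iff:
  assumes "x \<in> topspace X" and "f \<in> carrier (baire_one_ring X)"
  shows "eval_kernel X x \<in> max_ideals (baire_one_ring X) - max_hull (baire_one_ring X) f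
    \<longleftrightarrow> f x \<noteq> 0"
  using assms maximalideal_eval_kernel [OF assms(1)]
  by (simp add: max_ideals_def max_hull_def eval_kernel_def)

lemma eval_kernel_weak_fsigma_continuous:
  "weak_fsigma_continuous_map X (hull_kernel_topology (baire_one_ring X))
     (max_basic_opens (baire_one_ring X)) (eval_kernel X)"
  unfolding weak_fsigma_continuous_map_def
proof (intro conjI ballI)
  let ?R = "baire_one_ring X"
  show "eval_kernel X \<in> topspace X \<rightarrow> topspace (hull_kernel_topology ?R)"
    by (simp add: topspace_hull_kernel_topology cring_baire_one_ring max_ideals_def
        maximalideal_eval_kernel)
  fix U assume "U \<in> max_basic_opens ?R"
  then obtain f where f: "f \<in> carrier ?R" and U: "U = max_ideals ?R - max_hull ?R f"
    unfolding max_basic_opens_def by blast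
  have "{x \<in> topspace X. eval_kernel X x \<in> U} = {x \<in> topspace X. f x \<noteq> 0}"
    unfolding U using eval_kernel_in_basic_open_iff [OF _ f] by blast
  moreover have "baire_one X f"
    using f by (simp add: baire_one_ring_simps)
  ultimately show "fsigma_in X {x \<in> topspace X. eval_kernel X x \<in> U}"
    by (simp add: fsigma_in_cozero_baire_one)
qed

text \<open>
  Every maximal ideal contains the zero function. Hence a nonempty basic open set
  \<open>{M. f \<notin> M}\<close> is given by some \<open>f\<close> with \<open>f x \<noteq> 0\<close> for a point \<open>x\<close>, and then \<open>M\<^sub>x\<close>
  belongs to it.
\<close>
lemma eval_kernel_dense:
  "hull_kernel_topology (baire_one_ring X) closure_of (eval_kernel X ` topspace X) =
     topspace (hull_kernel_topology (baire_one_ring X))"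
  unfolding dense_intersects_open
proof (intro allI impI)
  let ?R = "baire_one_ring X"
  interpret R: cring ?R by (rule cring_baire_one_ring)
  fix T assume "openin (hull_kernel_topology ?R) T \<and> T \<noteq> {}"
  then obtain M U where "M \<in> U" "U \<in> max_basic_opens ?R" "U \<subseteq> T"
    by (fastforce simp: openin_hull_kernel_topology [OF cring_baire_one_ring] union_of_def)
  then obtain f where f: "f \<in> carrier ?R" and M: "maximalideal M ?R" "f \<notin> M"
    and sub: "max_ideals ?R - max_hull ?R f \<subseteq> T"
    by (auto simp: max_basic_opens_def max_ideals_def max_hull_def)
  interpret M: maximalideal M ?R by (rule M)
  have "\<exists>x\<in>topspace X. f x \<noteq> 0"
  proof (rule ccontr)
    assume "\<not> (\<exists>x\<in>topspace X. f x \<noteq> 0)"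
    then have "f = \<zero>\<^bsub>?R\<^esub>"
      using f by (auto simp: baire_one_ring_simps extensional_def restrict_def)
    with M(2) M.zero_closed show False by simp
  qed
  then obtain x where x: "x \<in> topspace X" and "f x \<noteq> 0" by blast
  then have "eval_kernel X x \<in> T"
    using eval_kernel_in_basic_open_iff [OF x f] sub by blast
  with x show "eval_kernel X ` topspace X \<inter> T \<noteq> {}" by blast
qed

section \<open>Injectivity and continuity of the inverse\<close>

lemma baire_one_ring_separates:
  assumes "completely_regular_space X" and "openin X U" and "x \<in> U"
  obtains f where "f \<in> carrier (baire_one_ring X)" and "f x \<noteq> 0"
    and "\<And>y. y \<in> topspace X - U \<Longrightarrow> f y = 0"
proof -
  have x: "x \<in> topspace X"
    using assms openin_subset by blast
  with assms have "closedin X (topspace X - U)" "x \<in> topspace X - (topspace X - U)"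
    by auto
  with assms(1) obtain g :: "'a \<Rightarrow> real"
    where g: "continuous_map X (top_of_set {0..1}) g" "g x = 0" "g ` (topspace X - U) \<subseteq> {1}"
    unfolding completely_regular_space_def by metis
  have "continuous_map X euclideanreal (\<lambda>y. 1 - g y)"
    using g(1) by (intro continuous_map_diff) (auto simp: continuous_map_in_subtopology)
  then have "(\<lambda>y\<in>topspace X. 1 - g y) \<in> carrier (baire_one_ring X)"
    by (simp add: baire_one_ring_simps continuous_imp_baire_one)
  then show thesis
    by (rule that) (use g x in auto)
qed

text \<open>
  Singletons are closed, so for \<open>x \<noteq> y\<close> the complement of \<open>{y}\<close> is a neighbourhood of \<open>x\<close>, and
  separation yields a function in \<open>M\<^sub>y\<close> but not in \<open>M\<^sub>x\<close>.
\<close>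
lemma inj_on_eval_kernel:
  assumes "completely_regular_space X" and "t1_space X"
  shows "inj_on (eval_kernel X) (topspace X)"
proof (rule inj_onI, rule ccontr)
  fix x y
  assume x: "x \<in> topspace X" and y: "y \<in> topspace X"
    and eq: "eval_kernel X x = eval_kernel X y" and "x \<noteq> y"
  have "openin X (topspace X - {y})"
    using assms(2) y by (simp add: t1_space_closedin_singleton openin_diff)
  moreover have "x \<in> topspace X - {y}"
    using x \<open>x \<noteq> y\<close> by simp
  ultimately obtain f where "f \<in> carrier (baire_one_ring X)" "f x \<noteq> 0" "f y = 0"
    using baire_one_ring_separates [OF assms(1)] y by (metis Diff_iff insertI1)
  then have "f \<in> eval_kernel X y" "f \<notin> eval_kernel X x"
    by (simp_all add: eval_kernel_def)
  with eq show False by simp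
qed

text \<open>
  The inverse is continuous exactly when the images of open sets are relatively open. The image
  of an open set \<open>U\<close> is the trace of the union of those basic open sets \<open>{M. f \<notin> M}\<close> for which
  the cozero set of \<open>f\<close> lies in \<open>U\<close>, because these cozero sets cover \<open>U\<close>.
\<close>
lemma continuous_map_inv_eval_kernel:
  assumes reg: "completely_regular_space X" and "t1_space X"
  shows "continuous_map
           (subtopology (hull_kernel_topology (baire_one_ring X)) (eval_kernel X ` topspace X)) X
           (the_inv_into (topspace X) (eval_kernel X))"
proof -
  let ?R = "baire_one_ring X" and ?\<phi> = "eval_kernel X"
  let ?H = "hull_kernel_topology ?R"
  have inj: "inj_on ?\<phi> (topspace X)"
    using assms by (rule inj_on_eval_kernel)
  have top: "topspace (subtopology ?H (?\<phi> ` topspace X)) = ?\<phi> ` topspace X"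
    using eval_kernel_weak_fsigma_continuous [of X]
    by (auto simp: weak_fsigma_continuous_map_def)
  show ?thesis
    unfolding continuous_map_def top
  proof (intro conjI allI impI)
    show "the_inv_into (topspace X) ?\<phi> \<in> ?\<phi> ` topspace X \<rightarrow> topspace X"
      by (auto simp: the_inv_into_f_f [OF inj])
    fix U assume U: "openin X U"
    define F where "F = {f \<in> carrier ?R. \<forall>y\<in>topspace X - U. f y = 0}"
    define T where "T = (\<Union>f\<in>F. max_ideals ?R - max_hull ?R f)"
    have "openin ?H T"
      unfolding openin_hull_kernel_topology [OF cring_baire_one_ring] union_of_def T_def F_def
        max_basic_opens_def arbitrary_def
      by (intro exI [of _ "(\<lambda>f. max_ideals ?R - max_hull ?R f) ` F"]) (auto simp: F_def)
    moreover have "?\<phi> x \<in> T \<longleftrightarrow> x \<in> U" if x: "x \<in> topspace X" for x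
    proof
      assume "?\<phi> x \<in> T"
      then obtain f where f: "f \<in> F" "?\<phi> x \<in> max_ideals ?R - max_hull ?R f"
        unfolding T_def by blast
      then have "f x \<noteq> 0"
        using eval_kernel_in_basic_open_iff [OF x] by (simp add: F_def)
      with f x show "x \<in> U" by (auto simp: F_def)
    next
      assume "x \<in> U"
      then obtain f where f: "f \<in> carrier ?R" "f x \<noteq> 0" "\<And>y. y \<in> topspace X - U \<Longrightarrow> f y = 0"
        using baire_one_ring_separates [OF reg U] by blast
      then have "f \<in> F" by (simp add: F_def)
      with f show "?\<phi> x \<in> T"
        using eval_kernel_in_basic_open_iff [OF x f(1)] unfolding T_def by blast
    qed
    then have "{M \<in> ?\<phi> ` topspace X. the_inv_into (topspace X) ?\<phi> M \<in> U} = T \<inter> ?\<phi> ` topspace X"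
      by (auto simp: the_inv_into_f_f [OF inj])
    ultimately show "openin (subtopology ?H (?\<phi> ` topspace X))
        {M \<in> ?\<phi> ` topspace X. the_inv_into (topspace X) ?\<phi> M \<in> U}"
      unfolding openin_subtopology by blast
  qed
qed

theorem theorem4p4:
  fixes X :: "'a topology"
  assumes "normal_space X" and "t1_space X"
  shows "\<exists>\<phi>. weak_fsigma_embedding_map X (hull_kernel_topology (baire_one_ring X))
               (max_basic_opens (baire_one_ring X)) \<phi> \<and>
             hull_kernel_topology (baire_one_ring X) closure_of (\<phi> ` topspace X) =
               topspace (hull_kernel_topology (baire_one_ring X))"
proof -
  have "completely_regular_space X"
    using assms by (simp add: normal_imp_completely_regular_space_gen)
  with assms(2) have "weak_fsigma_embedding_map X (hull_kernel_topology (baire_one_ring X))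
      (max_basic_opens (baire_one_ring X)) (eval_kernel X)"
    by (simp add: weak_fsigma_embedding_map_def inj_on_eval_kernel
        eval_kernel_weak_fsigma_continuous continuous_map_inv_eval_kernel)
  with eval_kernel_dense show ?thesis by blast
qed

end
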